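(* If $\mathbb{T}$ is an enriched finitary monad on $\mathsf{Pos}$, then the algebras of its associated variety $\mathcal{V}_{\mathbb{T}}$ are coherent. Conversely, for every variety $\mathcal{V}$ of coherent $\Sigma$-algebras ($\Sigma$ any signature), the free-algebra monad $\mathbb{T}_{\mathcal{V}}$ is enriched.
   Context: $\mathsf{Pos}$ is the category of posets and monotone maps. $\mathsf{Pos}_{\mathsf f}$ is a fixed representative set of all finite posets up to isomorphism; its members are called contexts, and the elements of a context are called variables. For posets $X,Y$, $\mathsf{Pos}_0(X,Y)$ is the set of monotone maps $X\to Y$, and $\mathsf{Pos}(X,Y)$ is that set ordered pointwise. $|X|$ denotes the underlying set of a poset $X$. A monad on $\mathsf{Pos}$ is finitary if its underlying functor $T$ preserves filtered colimits, and enriched if $T$ is locally monotone, i.e. $f\le g$ in $\mathsf{Pos}(X,Y)$ implies $Tf\le Tg$ in $\mathsf{Pos}(TX,TY)$. A signature $\Sigma$ is a family of sets $(\Sigma_\Gamma)_{\Gamma\in\mathsf{Pos}_{\mathsf f}}$; elements $\sigma\in\Sigma_\Gamma$ are operation symbols of arity $\Gamma$. A $\Sigma$-algebra is a poset $A$ with a function $\sigma_A\colon\mathsf{Pos}_0(\Gamma,A)\to A$ for every $\Gamma\in\mathsf{Pos}_{\mathsf f}$ and $\sigma\in\Sigma_\Gamma$. It is coherent if each $\sigma_A$ is monotone as a map $\mathsf{Pos}(\Gamma,A)\to A$. A homomorphism $h\colon A\to B$ is a monotone map with $h(\sigma_A(f))=\sigma_B(h\cdot f)$ for all $\sigma\in\Sigma_\Gamma$,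 $f\in\mathsf{Pos}_0(\Gamma,A)$. $\mathsf{Alg}\,\Sigma$ is the category of $\Sigma$-algebras and homomorphisms, and $\mathsf{Alg}_{\mathsf c}\Sigma$ its full subcategory of coherent algebras. For a context $\Gamma$, the set $\mathscr{T}(\Gamma)$ of terms is the least set containing $|\Gamma|$ such that for every $\sigma\in\Sigma_\Delta$ and every function $g\colon|\Delta|\to\mathscr{T}(\Gamma)$ there is a term $\sigma(g)\in\mathscr{T}(\Gamma)$ (terms are formed freely, ignoring the order of arities). An operation symbol $\sigma\in\Sigma_\Gamma$ is also regarded as the term $\sigma(u_\Gamma)\in\mathscr{T}(\Gamma)$, where $u_\Gamma\colon|\Gamma|\to\mathscr{T}(\Gamma)$ is the inclusion. Given a $\Sigma$-algebra $A$ and a monotone $f\colon\Gamma\to A$, the evaluation is the partial map $f^{\#}\colon\mathscr{T}(\Gamma)\to|A|$ defined recursively: $f^{\#}(x)=f(x)$ for $x\in|\Gamma|$; for $\sigma\in\Sigma_\Delta$ and $g\colon|\Delta|\to\mathscr{T}(\Gamma)$, $f^{\#}(\sigma(g))$ is defined iff all $f^{\#}(g(i))$, $i\in|\Delta|$, are defined and $i\le j$ in $\Delta$ implies $f^{\#}(g(i))\le f^{\#}(g(j))$ in $A$, and then $f^{\#}(\sigma(g))=\sigma_A(f^{\#}\cdot g)$. An inequation in context $\Gamma\vdash s\le t$ is a pair $s,t\in\mathscr{T}(\Gamma)$; $A$ satisfies it if for every monotone $f\colon\Gamma\to A$ both $f^{\#}(s)$ and $f^{\#}(t)$ are defined and $f^{\#}(s)\le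 f^{\#}(t)$. $\Gamma\vdash s=t$ denotes the conjunction of $\Gamma\vdash s\le t$ and $\Gamma\vdash t\le s$. A variety of (coherent) $\Sigma$-algebras is the full subcategory of $\mathsf{Alg}\,\Sigma$ (respectively $\mathsf{Alg}_{\mathsf c}\Sigma$) of all algebras satisfying a given set of inequations in context. The forgetful functor from such a variety $\mathcal{V}$ to $\mathsf{Pos}$ has a left adjoint; the ensuing monad on $\mathsf{Pos}$ is the free-algebra monad $\mathbb{T}_{\mathcal{V}}$ of $\mathcal{V}$. Given a finitary monad $\mathbb{T}=(T,\eta,\mu)$ on $\mathsf{Pos}$, write $k^{*}=\mu_Y\cdot Tk\colon TX\to TY$ for monotone $k\colon X\to TY$. The associated variety $\mathcal{V}_{\mathbb{T}}$ (a variety of $\Sigma$-algebras) has the signature $\Sigma_\Gamma=|T\Gamma|$ ($\Gamma\in\mathsf{Pos}_{\mathsf f}$) and is specified by inequations of the following two types, for every context $\Gamma$: (1) $\Gamma\vdash\sigma\le\tau$ for all $\sigma\le\tau$ in $T\Gamma$; (2) $\Gamma\vdash k^{*}(\sigma)=\sigma(k)$ for all $\Delta\in\mathsf{Pos}_{\mathsf f}$, all monotone $k\colon\Delta\to T\Gamma$ and all $\sigma\in T\Delta$. Here elements of $T\Gamma$ are operation symbols of arity $\Gamma$ regarded as terms in $\mathscr{T}(\Gamma)$, and $\sigma(k)$ is the term built from $\sigma\in\Sigma_\Delta$ and the terms $k(i)$, $i\in|\Delta|$.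
   Formalization: The associated variety is here also required to satisfy the unit equations Γ ⊢ η_Γ(x) = x for every context Γ and variable x; with only inequations (1) and (2) the first claim fails, already for the identity monad. *)

theory Defs
  imports Main "HOL-Library.FuncSet"
begin

section \<open>The category of posets\<close>

text \<open>
  A poset is represented by its order relation \<open>X\<close> with \<open>Partial_order X\<close>; by reflexivity its
  underlying set \<open>|X|\<close> is \<open>Field X\<close>.  HOL has no class of all sets, so the type variable
  \<open>'u\<close> plays the role of the universe: \<open>Pos\<close> is the category of all posets on subsets of
  \<open>'u\<close>, and small index categories have their objects and arrows in \<open>'u\<close>.  The universe is
  arbitrary, apart from being required to be infinite where this matters (it then contains a copy
  of every finite poset and is closed under all colimits used below).

  Monotone maps are extensional functions on the underlying sets, so that equality of functions
  is equality of maps.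
\<close>

definition Pos0 :: "'a rel \<Rightarrow> 'b rel \<Rightarrow> ('a \<Rightarrow> 'b) set" where
  "Pos0 X Y = {f \<in> Field X \<rightarrow>\<^sub>E Field Y. \<forall>(x, x') \<in> X. (f x, f x') \<in> Y}"

definition Pos :: "'a rel \<Rightarrow> 'b rel \<Rightarrow> ('a \<Rightarrow> 'b) rel" where
  "Pos X Y = {(f, g). f \<in> Pos0 X Y \<and> g \<in> Pos0 X Y \<and> (\<forall>x \<in> Field X. (f x, g x) \<in> Y)}"

abbreviation pos_id :: "'a rel \<Rightarrow> 'a \<Rightarrow> 'a" where
  "pos_id X \<equiv> (\<lambda>x \<in> Field X. x)"

abbreviation pos_comp :: "'a rel \<Rightarrow> ('b \<Rightarrow> 'c) \<Rightarrow> ('a \<Rightarrow> 'b) \<Rightarrow> 'a \<Rightarrow> 'c" where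
  "pos_comp X g f \<equiv> compose (Field X) g f"

definition pos_isomorphic :: "'a rel \<Rightarrow> 'b rel \<Rightarrow> bool" where
  "pos_isomorphic X Y \<longleftrightarrow>
     (\<exists>f \<in> Pos0 X Y. \<exists>g \<in> Pos0 Y X. pos_comp X g f = pos_id X \<and> pos_comp Y f g = pos_id Y)"

definition representative_contexts :: "'u rel set \<Rightarrow> bool" where
  "representative_contexts Posf \<longleftrightarrow>
     (\<forall>\<Gamma> \<in> Posf. Partial_order \<Gamma> \<and> finite (Field \<Gamma>)) \<and>
     (\<forall>X :: 'u rel. Partial_order X \<and> finite (Field X) \<longrightarrow> (\<exists>!\<Gamma>. \<Gamma> \<in> Posf \<and> pos_isomorphic X \<Gamma>))"


section \<open>Filtered colimits of posets\<close>

record 'u cat =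
  Ob :: "'u set"
  Ar :: "'u set"
  Dom :: "'u \<Rightarrow> 'u"
  Cod :: "'u \<Rightarrow> 'u"
  Ide :: "'u \<Rightarrow> 'u"
  Cmp :: "'u \<Rightarrow> 'u \<Rightarrow> 'u"

definition Hom :: "'u cat \<Rightarrow> 'u \<Rightarrow> 'u \<Rightarrow> 'u set" where
  "Hom J i j = {a \<in> Ar J. Dom J a = i \<and> Cod J a = j}"

definition is_category :: "'u cat \<Rightarrow> bool" where
  "is_category J \<longleftrightarrow>
     (\<forall>a \<in> Ar J. Dom J a \<in> Ob J \<and> Cod J a \<in> Ob J) \<and>
     (\<forall>i \<in> Ob J. Ide J i \<in> Hom J i i) \<and>
     (\<forall>i j k a b. a \<in> Hom J i j \<and> b \<in> Hom J j k \<longrightarrow> Cmp J b a \<in> Hom J i k) \<and>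
     (\<forall>i j a. a \<in> Hom J i j \<longrightarrow> Cmp J a (Ide J i) = a \<and> Cmp J (Ide J j) a = a) \<and>
     (\<forall>i j k l a b c. a \<in> Hom J i j \<and> b \<in> Hom J j k \<and> c \<in> Hom J k l \<longrightarrow>
        Cmp J c (Cmp J b a) = Cmp J (Cmp J c b) a)"

definition filtered_category :: "'u cat \<Rightarrow> bool" where
  "filtered_category J \<longleftrightarrow>
     is_category J \<and> Ob J \<noteq> {} \<and>
     (\<forall>i \<in> Ob J. \<forall>j \<in> Ob J. \<exists>k \<in> Ob J. Hom J i k \<noteq> {} \<and> Hom J j k \<noteq> {}) \<and>
     (\<forall>i j. \<forall>a \<in> Hom J i j. \<forall>b \<in> Hom J i j. \<exists>k \<in> Ob J. \<exists>c \<in> Hom J j k. Cmp J c a = Cmp J c b)"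

definition pos_diagram :: "'u cat \<Rightarrow> ('u \<Rightarrow> 'u rel) \<Rightarrow> ('u \<Rightarrow> 'u \<Rightarrow> 'u) \<Rightarrow> bool" where
  "pos_diagram J D d \<longleftrightarrow>
     (\<forall>i \<in> Ob J. Partial_order (D i)) \<and>
     (\<forall>i j. \<forall>a \<in> Hom J i j. d a \<in> Pos0 (D i) (D j)) \<and>
     (\<forall>i \<in> Ob J. d (Ide J i) = pos_id (D i)) \<and>
     (\<forall>i j k. \<forall>a \<in> Hom J i j. \<forall>b \<in> Hom J j k. d (Cmp J b a) = pos_comp (D i) (d b) (d a))"

definition pos_cocone ::
  "'u cat \<Rightarrow> ('u \<Rightarrow> 'u rel) \<Rightarrow> ('u \<Rightarrow> 'u \<Rightarrow> 'u) \<Rightarrow> 'u rel \<Rightarrow> ('u \<Rightarrow> 'u \<Rightarrow> 'u) \<Rightarrow> bool" where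
  "pos_cocone J D d C c \<longleftrightarrow>
     Partial_order C \<and>
     (\<forall>i \<in> Ob J. c i \<in> Pos0 (D i) C) \<and>
     (\<forall>i j. \<forall>a \<in> Hom J i j. pos_comp (D i) (c j) (d a) = c i)"

definition pos_colimit ::
  "'u cat \<Rightarrow> ('u \<Rightarrow> 'u rel) \<Rightarrow> ('u \<Rightarrow> 'u \<Rightarrow> 'u) \<Rightarrow> 'u rel \<Rightarrow> ('u \<Rightarrow> 'u \<Rightarrow> 'u) \<Rightarrow> bool" where
  "pos_colimit J D d C c \<longleftrightarrow>
     pos_cocone J D d C c \<and>
     (\<forall>B b. pos_cocone J D d B b \<longrightarrow>
        (\<exists>!h. h \<in> Pos0 C B \<and> (\<forall>i \<in> Ob J. pos_comp (D i) h (c i) = b i)))"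


section \<open>Monads on posets\<close>

text \<open>\<open>TM M X Y\<close> is the action of the underlying functor on the monotone maps from \<open>X\<close> to \<open>Y\<close>.\<close>

record 'u pmonad =
  TO :: "'u rel \<Rightarrow> 'u rel"
  TM :: "'u rel \<Rightarrow> 'u rel \<Rightarrow> ('u \<Rightarrow> 'u) \<Rightarrow> 'u \<Rightarrow> 'u"
  unit :: "'u rel \<Rightarrow> 'u \<Rightarrow> 'u"
  mult :: "'u rel \<Rightarrow> 'u \<Rightarrow> 'u"

definition pos_functor ::
  "('u rel \<Rightarrow> 'u rel) \<Rightarrow> ('u rel \<Rightarrow> 'u rel \<Rightarrow> ('u \<Rightarrow> 'u) \<Rightarrow> 'u \<Rightarrow> 'u) \<Rightarrow> bool" where
  "pos_functor T t \<longleftrightarrow>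
     (\<forall>X. Partial_order X \<longrightarrow> Partial_order (T X)) \<and>
     (\<forall>X Y f. Partial_order X \<and> Partial_order Y \<and> f \<in> Pos0 X Y \<longrightarrow> t X Y f \<in> Pos0 (T X) (T Y)) \<and>
     (\<forall>X. Partial_order X \<longrightarrow> t X X (pos_id X) = pos_id (T X)) \<and>
     (\<forall>X Y Z f g. Partial_order X \<and> Partial_order Y \<and> Partial_order Z \<and>
        f \<in> Pos0 X Y \<and> g \<in> Pos0 Y Z \<longrightarrow>
        t X Z (pos_comp X g f) = pos_comp (T X) (t Y Z g) (t X Y f))"

definition pos_monad :: "'u pmonad \<Rightarrow> bool" where
  "pos_monad M \<longleftrightarrow>
     pos_functor (TO M) (TM M) \<and>
     (\<forall>X. Partial_order X \<longrightarrow>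
        unit M X \<in> Pos0 X (TO M X) \<and>
        mult M X \<in> Pos0 (TO M (TO M X)) (TO M X)) \<and>
     (\<forall>X Y f. Partial_order X \<and> Partial_order Y \<and> f \<in> Pos0 X Y \<longrightarrow>
        pos_comp X (TM M X Y f) (unit M X) = pos_comp X (unit M Y) f \<and>
        pos_comp (TO M (TO M X)) (TM M X Y f) (mult M X) =
          pos_comp (TO M (TO M X)) (mult M Y) (TM M (TO M X) (TO M Y) (TM M X Y f))) \<and>
     (\<forall>X. Partial_order X \<longrightarrow>
        pos_comp (TO M X) (mult M X) (unit M (TO M X)) = pos_id (TO M X) \<and>
        pos_comp (TO M X) (mult M X) (TM M X (TO M X) (unit M X)) = pos_id (TO M X) \<and>
        pos_comp (TO M (TO M (TO M X))) (mult M X) (mult M (TO M X)) =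
          pos_comp (TO M (TO M (TO M X))) (mult M X) (TM M (TO M (TO M X)) (TO M X) (mult M X)))"

definition finitary :: "'u pmonad \<Rightarrow> bool" where
  "finitary M \<longleftrightarrow>
     (\<forall>J D d C c. filtered_category J \<and> pos_diagram J D d \<and> pos_colimit J D d C c \<longrightarrow>
        pos_colimit J (\<lambda>i. TO M (D i)) (\<lambda>a. TM M (D (Dom J a)) (D (Cod J a)) (d a))
          (TO M C) (\<lambda>i. TM M (D i) C (c i)))"

definition enriched :: "'u pmonad \<Rightarrow> bool" where
  "enriched M \<longleftrightarrow>
     (\<forall>X Y f g. Partial_order X \<and> Partial_order Y \<and> (f, g) \<in> Pos X Y \<longrightarrow>
        (TM M X Y f, TM M X Y g) \<in> Pos (TO M X) (TO M Y))"

definition kleisli_ext :: "'u pmonad \<Rightarrow> 'u rel \<Rightarrow> 'u rel \<Rightarrow> ('u \<Rightarrow> 'u) \<Rightarrow> 'u \<Rightarrow> 'u" where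
  "kleisli_ext M X Y k = pos_comp (TO M X) (mult M Y) (TM M X (TO M Y) k)"


section \<open>Algebras for a signature\<close>

text \<open>
  A signature assigns to each context \<open>\<Gamma> \<in> Posf\<close> a set \<open>\<Sigma> \<Gamma>\<close> of symbols.  These sets need not be
  disjoint, so symbols occur together with their arity in algebras and terms.  Values of \<open>\<Sigma>\<close> and
  of operations outside of \<open>Posf\<close> or \<open>\<Sigma> \<Gamma>\<close> are irrelevant.
\<close>

type_synonym ('u, 's) signature = "'u rel \<Rightarrow> 's set"

record ('u, 's, 'a) algebra =
  pos :: "'a rel"
  opn :: "'u rel \<Rightarrow> 's \<Rightarrow> ('u \<Rightarrow> 'a) \<Rightarrow> 'a"

definition is_algebra :: "'u rel set \<Rightarrow> ('u, 's) signature \<Rightarrow> ('u, 's, 'a) algebra \<Rightarrow> bool" where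
  "is_algebra Posf \<Sigma> A \<longleftrightarrow>
     Partial_order (pos A) \<and>
     (\<forall>\<Gamma> \<in> Posf. \<forall>\<sigma> \<in> \<Sigma> \<Gamma>. \<forall>f \<in> Pos0 \<Gamma> (pos A). opn A \<Gamma> \<sigma> f \<in> Field (pos A))"

definition coherent :: "'u rel set \<Rightarrow> ('u, 's) signature \<Rightarrow> ('u, 's, 'a) algebra \<Rightarrow> bool" where
  "coherent Posf \<Sigma> A \<longleftrightarrow>
     (\<forall>\<Gamma> \<in> Posf. \<forall>\<sigma> \<in> \<Sigma> \<Gamma>. \<forall>(f, g) \<in> Pos \<Gamma> (pos A). (opn A \<Gamma> \<sigma> f, opn A \<Gamma> \<sigma> g) \<in> pos A)"

definition homs ::
  "'u rel set \<Rightarrow> ('u, 's) signature \<Rightarrow> ('u, 's, 'a) algebra \<Rightarrow> ('u, 's, 'b) algebra \<Rightarrow> ('a \<Rightarrow> 'b) set"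
  where
  "homs Posf \<Sigma> A B =
     {h \<in> Pos0 (pos A) (pos B).
        \<forall>\<Gamma> \<in> Posf. \<forall>\<sigma> \<in> \<Sigma> \<Gamma>. \<forall>f \<in> Pos0 \<Gamma> (pos A).
          h (opn A \<Gamma> \<sigma> f) = opn B \<Gamma> \<sigma> (pos_comp \<Gamma> h f)}"


section \<open>Terms, inequations in context and varieties\<close>

text \<open>
  \<open>App \<Delta> \<sigma> g\<close> is the term \<open>\<sigma>(g)\<close> for the operation symbol \<open>\<sigma>\<close> of arity \<open>\<Delta>\<close>.  In \<open>terms\<close>, the
  family \<open>g\<close> is extensional on \<open>|\<Delta>|\<close>; it is not required to be monotone in any sense.
\<close>

datatype ('u, 's) trm = Var 'u | App "'u rel" 's "'u \<Rightarrow> ('u, 's) trm"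

inductive_set "terms" :: "'u rel set \<Rightarrow> ('u, 's) signature \<Rightarrow> 'u rel \<Rightarrow> ('u, 's) trm set"
  for Posf :: "'u rel set" and \<Sigma> :: "('u, 's) signature" and \<Gamma> :: "'u rel" where
  Var: "x \<in> Field \<Gamma> \<Longrightarrow> Var x \<in> terms Posf \<Sigma> \<Gamma>"
| App: "\<Delta> \<in> Posf \<Longrightarrow> \<sigma> \<in> \<Sigma> \<Delta> \<Longrightarrow> g \<in> extensional (Field \<Delta>) \<Longrightarrow>
        (\<And>i. i \<in> Field \<Delta> \<Longrightarrow> g i \<in> terms Posf \<Sigma> \<Gamma>) \<Longrightarrow> App \<Delta> \<sigma> g \<in> terms Posf \<Sigma> \<Gamma>"

definition op_term :: "'u rel \<Rightarrow> 's \<Rightarrow> ('u, 's) trm" where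
  "op_term \<Gamma> \<sigma> = App \<Gamma> \<sigma> (\<lambda>x \<in> Field \<Gamma>. Var x)"

text \<open>The partial evaluation map \<open>f\<^sup>#\<close>, with \<open>None\<close> for an undefined value.\<close>

primrec eval_term :: "('u, 's, 'a) algebra \<Rightarrow> ('u \<Rightarrow> 'a) \<Rightarrow> ('u, 's) trm \<Rightarrow> 'a option" where
  "eval_term A f (Var x) = Some (f x)"
| "eval_term A f (App \<Delta> \<sigma> g) =
     (if (\<forall>i \<in> Field \<Delta>. eval_term A f (g i) \<noteq> None) \<and>
         (\<forall>i j. (i, j) \<in> \<Delta> \<longrightarrow> (the (eval_term A f (g i)), the (eval_term A f (g j))) \<in> pos A)
      then Some (opn A \<Delta> \<sigma> (\<lambda>i \<in> Field \<Delta>. the (eval_term A f (g i))))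
      else None)"

text \<open>The triple \<open>(\<Gamma>, s, t)\<close> is the inequation \<open>\<Gamma> \<turnstile> s \<le> t\<close>.\<close>

type_synonym ('u, 's) ineq = "'u rel \<times> ('u, 's) trm \<times> ('u, 's) trm"

definition inequations :: "'u rel set \<Rightarrow> ('u, 's) signature \<Rightarrow> ('u, 's) ineq set" where
  "inequations Posf \<Sigma> = {(\<Gamma>, s, t). \<Gamma> \<in> Posf \<and> s \<in> terms Posf \<Sigma> \<Gamma> \<and> t \<in> terms Posf \<Sigma> \<Gamma>}"

fun satisfies :: "('u, 's, 'a) algebra \<Rightarrow> ('u, 's) ineq \<Rightarrow> bool" where
  "satisfies A (\<Gamma>, s, t) \<longleftrightarrow>
     (\<forall>f \<in> Pos0 \<Gamma> (pos A). \<exists>a b. eval_term A f s = Some a \<and> eval_term A f t = Some b \<and> (a, b) \<in> pos A)"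

definition variety ::
  "'u rel set \<Rightarrow> ('u, 's) signature \<Rightarrow> ('u, 's) ineq set \<Rightarrow> ('u, 's, 'a) algebra set" where
  "variety Posf \<Sigma> I = {A. is_algebra Posf \<Sigma> A \<and> (\<forall>e \<in> I. satisfies A e)}"

definition coherent_variety ::
  "'u rel set \<Rightarrow> ('u, 's) signature \<Rightarrow> ('u, 's) ineq set \<Rightarrow> ('u, 's, 'a) algebra set" where
  "coherent_variety Posf \<Sigma> I = {A \<in> variety Posf \<Sigma> I. coherent Posf \<Sigma> A}"


section \<open>The free-algebra monad\<close>

text \<open>
  A left adjoint of the forgetful functor from the full subcategory \<open>V\<close> of algebras to posets is
  given by a universal arrow \<open>\<eta> X\<close> from each poset \<open>X\<close> to the forgetful functor.
\<close>

definition left_adjoint_forgetful ::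
  "'u rel set \<Rightarrow> ('u, 's) signature \<Rightarrow> ('u, 's, 'u) algebra set \<Rightarrow>
   ('u rel \<Rightarrow> ('u, 's, 'u) algebra) \<Rightarrow> ('u rel \<Rightarrow> 'u \<Rightarrow> 'u) \<Rightarrow> bool" where
  "left_adjoint_forgetful Posf \<Sigma> V F \<eta> \<longleftrightarrow>
     (\<forall>X. Partial_order X \<longrightarrow>
        F X \<in> V \<and> \<eta> X \<in> Pos0 X (pos (F X)) \<and>
        (\<forall>A \<in> V. \<forall>f \<in> Pos0 X (pos A). \<exists>!h. h \<in> homs Posf \<Sigma> (F X) A \<and> pos_comp X h (\<eta> X) = f))"

text \<open>The unique homomorphic extension of \<open>f\<close> along the universal arrow \<open>\<eta> X\<close>.\<close>

definition hom_ext ::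
  "'u rel set \<Rightarrow> ('u, 's) signature \<Rightarrow> ('u rel \<Rightarrow> ('u, 's, 'u) algebra) \<Rightarrow> ('u rel \<Rightarrow> 'u \<Rightarrow> 'u) \<Rightarrow>
   'u rel \<Rightarrow> ('u, 's, 'u) algebra \<Rightarrow> ('u \<Rightarrow> 'u) \<Rightarrow> 'u \<Rightarrow> 'u" where
  "hom_ext Posf \<Sigma> F \<eta> X A f = (THE h. h \<in> homs Posf \<Sigma> (F X) A \<and> pos_comp X h (\<eta> X) = f)"

definition free_algebra_monad ::
  "'u rel set \<Rightarrow> ('u, 's) signature \<Rightarrow> ('u rel \<Rightarrow> ('u, 's, 'u) algebra) \<Rightarrow> ('u rel \<Rightarrow> 'u \<Rightarrow> 'u) \<Rightarrow>
   'u pmonad" where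
  "free_algebra_monad Posf \<Sigma> F \<eta> =
     \<lparr>TO = (\<lambda>X. pos (F X)),
      TM = (\<lambda>X Y f. hom_ext Posf \<Sigma> F \<eta> X (F Y) (pos_comp X (\<eta> Y) f)),
      unit = \<eta>,
      mult = (\<lambda>X. hom_ext Posf \<Sigma> F \<eta> (pos (F X)) (F X) (pos_id (pos (F X))))\<rparr>"


section \<open>The variety associated with a monad\<close>

definition assoc_signature :: "'u pmonad \<Rightarrow> ('u, 'u) signature" where
  "assoc_signature M \<Gamma> = Field (TO M \<Gamma>)"

definition equation :: "'u rel \<Rightarrow> ('u, 's) trm \<Rightarrow> ('u, 's) trm \<Rightarrow> ('u, 's) ineq set" where
  "equation \<Gamma> s t = {(\<Gamma>, s, t), (\<Gamma>, t, s)}"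

definition order_ineqs :: "'u rel set \<Rightarrow> 'u pmonad \<Rightarrow> ('u, 'u) ineq set" where
  "order_ineqs Posf M = {(\<Gamma>, op_term \<Gamma> \<sigma>, op_term \<Gamma> \<tau>) | \<Gamma> \<sigma> \<tau>. \<Gamma> \<in> Posf \<and> (\<sigma>, \<tau>) \<in> TO M \<Gamma>}"

definition substitution_eqs :: "'u rel set \<Rightarrow> 'u pmonad \<Rightarrow> ('u, 'u) ineq set" where
  "substitution_eqs Posf M =
     \<Union>{equation \<Gamma> (op_term \<Gamma> (kleisli_ext M \<Delta> \<Gamma> k \<sigma>)) (App \<Delta> \<sigma> (\<lambda>i \<in> Field \<Delta>. op_term \<Gamma> (k i)))
        | \<Gamma> \<Delta> k \<sigma>. \<Gamma> \<in> Posf \<and> \<Delta> \<in> Posf \<and> k \<in> Pos0 \<Delta> (TO M \<Gamma>) \<and> \<sigma> \<in> Field (TO M \<Delta>)}"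

text \<open>
  The equations \<open>\<Gamma> \<turnstile> \<eta>(x) = x\<close> say that the element \<open>\<eta>(x)\<close> of \<open>T \<Gamma>\<close>, read as a term, is the
  variable \<open>x\<close>.  They do not follow from the order inequations and the substitution equations: for
  the identity monad, these two leave the operations \<open>\<eta>(x)\<close> arbitrary on maps that do not factor
  through the set of their values, and the algebras need be neither coherent nor
  Eilenberg-Moore algebras.
\<close>

definition unit_eqs :: "'u rel set \<Rightarrow> 'u pmonad \<Rightarrow> ('u, 'u) ineq set" where
  "unit_eqs Posf M =
     \<Union>{equation \<Gamma> (op_term \<Gamma> (unit M \<Gamma> x)) (Var x) | \<Gamma> x. \<Gamma> \<in> Posf \<and> x \<in> Field \<Gamma>}"

definition assoc_variety :: "'u rel set \<Rightarrow> 'u pmonad \<Rightarrow> ('u, 'u, 'a) algebra set" where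
  "assoc_variety Posf M =
     variety Posf (assoc_signature M)
       (order_ineqs Posf M \<union> substitution_eqs Posf M \<union> unit_eqs Posf M)"

end

theory Submission
  imports Defs
begin

text \<open>
  Both halves turn a comparison of two maps into a statement about one object.

  Let \<open>M\<close> be enriched, \<open>A\<close> an algebra of its associated variety, and \<open>f \<le> g\<close> two monotone maps
  from a context \<open>\<Gamma>\<close> to \<open>A\<close>.  The pair \<open>f \<le> g\<close> is a single monotone map \<open>h\<close> out of the cylinder
  \<open>\<Gamma> \<times> 2\<close>, which is again finite and hence, up to isomorphism, a context \<open>\<Delta>\<close>.  Its two end
  inclusions satisfy \<open>e\<^sub>0 \<le> e\<^sub>1\<close>, so enrichment gives \<open>T e\<^sub>0 \<sigma> \<le> T e\<^sub>1 \<sigma>\<close> in \<open>T \<Delta>\<close> for each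
  \<open>\<sigma> \<in> T \<Gamma>\<close>, and the order inequation for this pair compares the two operations of \<open>A\<close> at \<open>h\<close>.
  The operation \<open>T e \<sigma>\<close> at \<open>h\<close> is \<open>\<sigma>\<close> at \<open>h \<cdot> e\<close>, by the substitution equation for \<open>\<eta> \<cdot> e\<close>
  and the unit equations (\<open>opn_functor_action\<close>), and \<open>h \<cdot> e\<^sub>0 = f\<close>, \<open>h \<cdot> e\<^sub>1 = g\<close>.

  Conversely let \<open>p \<le> q\<close> be maps from \<open>X\<close> to a coherent algebra \<open>A\<close> of the variety, with
  homomorphic extensions \<open>p', q'\<close> to the free algebra \<open>F X\<close>.  The elements \<open>a\<close> with
  \<open>p' a \<le> q' a\<close> include the generators and, because the operations of \<open>A\<close> are monotone, are
  closed under the operations.  They form a subalgebra (\<open>closed_under_inserter\<close>), which stays in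
  the variety because the order is the induced one (\<open>subalgebra_in_coherent_variety\<close>).  A free
  algebra has no proper subalgebra in the variety containing the generators
  (\<open>free_algebra_induct\<close>), so \<open>p' \<le> q'\<close> everywhere.  For \<open>p = \<eta> \<cdot> f\<close> and \<open>q = \<eta> \<cdot> g\<close> this is
  \<open>T f \<le> T g\<close>.
\<close>

section \<open>Monotone maps\<close>

lemma Pos0_D:
  assumes "f \<in> Pos0 X Y"
  shows "f \<in> extensional (Field X)"
    and "\<And>x. x \<in> Field X \<Longrightarrow> f x \<in> Field Y"
    and "\<And>x x'. (x, x') \<in> X \<Longrightarrow> (f x, f x') \<in> Y"
  using assms unfolding Pos0_def by (auto simp: PiE_iff)

lemma restrict_in_Pos0:
  assumes "\<And>x x'. (x, x') \<in> X \<Longrightarrow> (f x, f x') \<in> Y"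
  shows "restrict f (Field X) \<in> Pos0 X Y"
proof -
  have "f x \<in> Field Y" if "x \<in> Field X" for x
    using that assms by (auto simp: Field_def)
  moreover have "x \<in> Field X" "x' \<in> Field X" if "(x, x') \<in> X" for x x'
    using that by (auto simp: Field_def)
  ultimately show ?thesis
    using assms unfolding Pos0_def by auto
qed

lemma pos_comp_in_Pos0:
  assumes "f \<in> Pos0 X Y" and "g \<in> Pos0 Y Z"
  shows "pos_comp X g f \<in> Pos0 X Z"
  unfolding compose_def using Pos0_D[OF assms(1)] Pos0_D[OF assms(2)]
  by (intro restrict_in_Pos0) auto

lemma Partial_order_iff:
  "Partial_order X \<longleftrightarrow> (\<forall>x \<in> Field X. (x, x) \<in> X) \<and> trans X \<and> antisym X"
  unfolding partial_order_on_def preorder_on_def refl_on_def by (auto intro: FieldI1 FieldI2)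

lemma Field_subposet:
  assumes "Partial_order X" "S \<subseteq> Field X"
  shows "Field (X \<inter> S \<times> S) = S"
proof
  show "Field (X \<inter> S \<times> S) \<subseteq> S"
    by (auto simp: Field_def)
  show "S \<subseteq> Field (X \<inter> S \<times> S)"
  proof
    fix x assume "x \<in> S"
    then have "(x, x) \<in> X \<inter> S \<times> S"
      using assms unfolding Partial_order_iff by blast
    then show "x \<in> Field (X \<inter> S \<times> S)"
      by (rule FieldI1)
  qed
qed

section \<open>Finite posets as contexts\<close>

text \<open>
  An infinite universe contains a copy of every finite poset, whatever the type of its elements.
  Only the retraction \<open>\<psi> \<cdot> \<phi> = id\<close> of the isomorphism is recorded.
\<close>

lemma finite_poset_context:
  fixes Z :: "'z rel" and Posf :: "'u rel set"
  assumes inf: "infinite (UNIV :: 'u set)"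
    and rep: "representative_contexts Posf"
    and Z: "Partial_order Z" and fin: "finite (Field Z)"
  obtains \<Delta> \<phi> \<psi> where "\<Delta> \<in> Posf" "\<phi> \<in> Pos0 Z \<Delta>" "\<psi> \<in> Pos0 \<Delta> Z"
    "\<And>z. z \<in> Field Z \<Longrightarrow> \<psi> (\<phi> z) = z"
proof -
  obtain B :: "'u set" where B: "finite B" "card B = card (Field Z)"
    using infinite_arbitrarily_large[OF inf] by blast
  then obtain e :: "'z \<Rightarrow> 'u" where "bij_betw e (Field Z) B"
    using finite_same_card_bij[OF fin, of B] by auto
  then have e: "inj_on e (Field Z)"
    by (rule bij_betw_imp_inj_on)
  define X where "X = {(e a, e b) | a b. (a, b) \<in> Z}"
  have Z': "\<And>z. z \<in> Field Z \<Longrightarrow> (z, z) \<in> Z" "trans Z" "antisym Z"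
    using Z unfolding Partial_order_iff by auto
  have X_I: "(e a, e b) \<in> X" if "(a, b) \<in> Z" for a b
    using that unfolding X_def by blast
  have X_E: "\<exists>a b. x = e a \<and> y = e b \<and> (a, b) \<in> Z \<and> a \<in> Field Z \<and> b \<in> Field Z"
    if "(x, y) \<in> X" for x y
    using that unfolding X_def by (blast intro: FieldI1 FieldI2)
  have X_iff: "(e a, e b) \<in> X \<longleftrightarrow> (a, b) \<in> Z" if "a \<in> Field Z" "b \<in> Field Z" for a b
  proof
    assume "(e a, e b) \<in> X"
    from X_E[OF this] show "(a, b) \<in> Z"
      using that inj_on_eq_iff[OF e] by auto
  qed (rule X_I)
  have FX: "Field X = e ` Field Z"
  proof
    show "Field X \<subseteq> e ` Field Z"
      unfolding Field_def[of X] using X_E by blast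
    show "e ` Field Z \<subseteq> Field X"
      using X_I Z'(1) by (blast intro: FieldI1)
  qed
  have "Partial_order X"
    unfolding Partial_order_iff
  proof (intro conjI)
    show "\<forall>x \<in> Field X. (x, x) \<in> X"
      using FX X_iff Z'(1) by auto
    show "trans X"
    proof (rule transI)
      fix x y z assume "(x, y) \<in> X" "(y, z) \<in> X"
      then obtain a b b' c where abc: "x = e a" "y = e b" "y = e b'" "z = e c"
        "(a, b) \<in> Z" "(b', c) \<in> Z" "b \<in> Field Z" "b' \<in> Field Z"
        using X_E[of x y] X_E[of y z] by blast
      then have "b = b'"
        using inj_onD[OF e] by simp
      then have "(a, c) \<in> Z"
        using abc transD[OF Z'(2)] by blast
      then show "(x, z) \<in> X"
        using abc X_I by simp
    qed
    show "antisym X"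
    proof (rule antisymI)
      fix x y assume "(x, y) \<in> X" "(y, x) \<in> X"
      moreover from this(1) obtain a b where ab: "x = e a" "y = e b" "a \<in> Field Z" "b \<in> Field Z"
        using X_E by blast
      ultimately show "x = y"
        using X_iff antisymD[OF Z'(3)] by auto
    qed
  qed
  moreover have "finite (Field X)"
    using fin FX by simp
  ultimately obtain \<Delta> where \<Delta>: "\<Delta> \<in> Posf" "pos_isomorphic X \<Delta>"
    using rep unfolding representative_contexts_def by blast
  then obtain p q where p: "p \<in> Pos0 X \<Delta>" and q: "q \<in> Pos0 \<Delta> X"
    and qp: "pos_comp X q p = pos_id X"
    unfolding pos_isomorphic_def by blast
  define e' where "e' = restrict e (Field Z)"
  define d where "d = restrict (inv_into (Field Z) e) (Field X)"
  have e': "e' \<in> Pos0 Z X"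
    unfolding e'_def by (rule restrict_in_Pos0) (rule X_I)
  have d: "d \<in> Pos0 X Z"
    unfolding d_def by (rule restrict_in_Pos0) (use X_E e in fastforce)
  show thesis
  proof
    show "\<Delta> \<in> Posf" by fact
    show "pos_comp Z p e' \<in> Pos0 Z \<Delta>" "pos_comp \<Delta> d q \<in> Pos0 \<Delta> Z"
      using e' d p q by (auto intro: pos_comp_in_Pos0)
    fix z assume z: "z \<in> Field Z"
    then have "e z \<in> Field X" using FX by simp
    then have "q (p (e z)) = e z" and "p (e z) \<in> Field \<Delta>"
      using fun_cong[OF qp, of "e z"] Pos0_D(2)[OF p] by (auto simp: compose_def)
    then show "pos_comp \<Delta> d q (pos_comp Z p e' z) = z"
      using z \<open>e z \<in> Field X\<close> e by (simp add: compose_def e'_def d_def)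
  qed
qed

text \<open>
  The poset \<open>X \<times> 2\<close>, where \<open>2\<close> is the type \<open>bool\<close> with \<open>False \<le> True\<close>.  Monotone maps out of it
  are pairs of monotone maps out of \<open>X\<close> with the first one below the second.
\<close>

definition cylinder :: "'a rel \<Rightarrow> ('a \<times> bool) rel" where
  "cylinder X = {((x, a), (y, b)). (x, y) \<in> X \<and> a \<le> b}"

lemma Field_cylinder: "Field (cylinder X) = Field X \<times> UNIV"
proof
  show "Field (cylinder X) \<subseteq> Field X \<times> UNIV"
    by (auto simp: Field_def cylinder_def)
  have "((x, b), (y, True)) \<in> cylinder X" "((x, False), (y, b)) \<in> cylinder X"
    if "(x, y) \<in> X" for x y b
    using that by (auto simp: cylinder_def)
  then show "Field X \<times> UNIV \<subseteq> Field (cylinder X)"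
    unfolding Field_def[of X] by (blast intro: FieldI1 FieldI2)
qed

lemma Partial_order_cylinder:
  assumes "Partial_order X"
  shows "Partial_order (cylinder X)"
  unfolding Partial_order_iff
proof (intro conjI)
  have X: "\<And>x. x \<in> Field X \<Longrightarrow> (x, x) \<in> X" "trans X" "antisym X"
    using assms unfolding Partial_order_iff by auto
  show "\<forall>z \<in> Field (cylinder X). (z, z) \<in> cylinder X"
    unfolding Field_cylinder using X(1) by (auto simp: cylinder_def)
  show "trans (cylinder X)"
  proof (rule transI, clarify)
    fix x a y b z c assume "((x, a), (y, b)) \<in> cylinder X" "((y, b), (z, c)) \<in> cylinder X"
    then have "(x, y) \<in> X" "(y, z) \<in> X" "a \<le> b" "b \<le> c"
      by (simp_all add: cylinder_def)
    then show "((x, a), (z, c)) \<in> cylinder X"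
      using transD[OF X(2), of x y z] by (auto simp: cylinder_def)
  qed
  show "antisym (cylinder X)"
  proof (rule antisymI, clarify)
    fix x a y b assume "((x, a), (y, b)) \<in> cylinder X" "((y, b), (x, a)) \<in> cylinder X"
    then show "x = y \<and> a = b"
      using antisymD[OF X(3), of x y] by (auto simp: cylinder_def)
  qed
qed

lemma pair_le_from_cylinder:
  assumes Y: "Partial_order Y" and fg: "(f, g) \<in> Pos X Y"
  shows "(\<lambda>(x, b) \<in> Field (cylinder X). if b then g x else f x) \<in> Pos0 (cylinder X) Y"
proof (rule restrict_in_Pos0)
  have mono: "(f x, f y) \<in> Y" "(g x, g y) \<in> Y" if "(x, y) \<in> X" for x y
    using that fg Pos0_D(3)[of f X Y x y] Pos0_D(3)[of g X Y x y] by (simp_all add: Pos_def)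
  have le: "(f x, g y) \<in> Y" if "(x, y) \<in> X" for x y
  proof -
    have "(f x, g x) \<in> Y"
      using FieldI1[OF that] fg by (simp add: Pos_def)
    with mono(2)[OF that] show ?thesis
      using Y unfolding Partial_order_iff by (meson transD)
  qed
  fix u v assume "(u, v) \<in> cylinder X"
  then show "((case u of (x, b) \<Rightarrow> if b then g x else f x),
      (case v of (x, b) \<Rightarrow> if b then g x else f x)) \<in> Y"
    using mono le by (cases u; cases v) (auto simp: cylinder_def)
qed

section \<open>Enriched monads have coherent algebras\<close>

lemma eval_op_term:
  assumes "h \<in> Pos0 \<Gamma> (pos A)"
  shows "eval_term A h (op_term \<Gamma> \<sigma>) = Some (opn A \<Gamma> \<sigma> h)"
proof -
  have "(\<lambda>i \<in> Field \<Gamma>. the (eval_term A h ((\<lambda>x \<in> Field \<Gamma>. Var x) i))) = h"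
    using Pos0_D(1)[OF assms] by (auto simp: fun_eq_iff extensional_def)
  moreover have "(i, j) \<in> \<Gamma> \<Longrightarrow> i \<in> Field \<Gamma> \<and> j \<in> Field \<Gamma>" for i j
    by (auto simp: Field_def)
  ultimately show ?thesis
    using Pos0_D(3)[OF assms] by (auto simp: op_term_def)
qed

lemma satisfies_equationD:
  assumes "\<forall>e \<in> equation \<Gamma> s t. satisfies A e" and "Partial_order (pos A)"
    and "h \<in> Pos0 \<Gamma> (pos A)"
  shows "eval_term A h s \<noteq> None" and "eval_term A h s = eval_term A h t"
proof -
  obtain a b where ab: "eval_term A h s = Some a" "eval_term A h t = Some b" "(a, b) \<in> pos A"
    using assms(1,3) by (auto simp: equation_def)
  moreover have "(b, a) \<in> pos A"
    using assms(1,3) ab by (auto simp: equation_def)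
  moreover have "antisym (pos A)"
    using assms(2) by (simp add: Partial_order_iff)
  ultimately show "eval_term A h s \<noteq> None" "eval_term A h s = eval_term A h t"
    by (auto dest: antisymD)
qed

text \<open>
  The map \<open>T e\<close> is the Kleisli extension of \<open>\<eta> \<cdot> e\<close>, so the substitution equation for \<open>\<eta> \<cdot> e\<close>
  rewrites \<open>T e \<sigma>\<close> to the term that applies \<open>\<sigma>\<close> to the operations \<open>\<eta> (e i)\<close>, and by the unit
  equations these are the variables \<open>e i\<close>.
\<close>

lemma opn_functor_action:
  assumes M: "pos_monad M" and A: "A \<in> assoc_variety Posf M"
    and contexts: "\<Gamma> \<in> Posf" "\<Delta> \<in> Posf" and po: "Partial_order \<Gamma>" "Partial_order \<Delta>"
    and e: "e \<in> Pos0 \<Gamma> \<Delta>" and \<sigma>: "\<sigma> \<in> Field (TO M \<Gamma>)" and h: "h \<in> Pos0 \<Delta> (pos A)"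
  shows "opn A \<Delta> (TM M \<Gamma> \<Delta> e \<sigma>) h = opn A \<Gamma> \<sigma> (pos_comp \<Gamma> h e)"
proof -
  have poA: "Partial_order (pos A)"
    and sat: "\<And>q. q \<in> substitution_eqs Posf M \<union> unit_eqs Posf M \<Longrightarrow> satisfies A q"
    using A by (auto simp: assoc_variety_def variety_def is_algebra_def)
  have \<eta>: "unit M \<Delta> \<in> Pos0 \<Delta> (TO M \<Delta>)" and poT: "Partial_order (TO M \<Delta>)"
    using M po by (auto simp: pos_monad_def pos_functor_def)
  define k where "k = pos_comp \<Gamma> (unit M \<Delta>) e"
  have k: "k \<in> Pos0 \<Gamma> (TO M \<Delta>)"
    unfolding k_def using e \<eta> by (rule pos_comp_in_Pos0)
  have Te: "TM M \<Gamma> \<Delta> e \<sigma> \<in> Field (TO M \<Delta>)"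
  proof -
    have "TM M \<Gamma> \<Delta> e \<in> Pos0 (TO M \<Gamma>) (TO M \<Delta>)"
      using M po e unfolding pos_monad_def pos_functor_def by blast
    from Pos0_D(2)[OF this \<sigma>] show ?thesis .
  qed
  have "kleisli_ext M \<Gamma> \<Delta> k \<sigma> = TM M \<Gamma> \<Delta> e \<sigma>"
  proof -
    have "TM M \<Gamma> (TO M \<Delta>) k = pos_comp (TO M \<Gamma>) (TM M \<Delta> (TO M \<Delta>) (unit M \<Delta>)) (TM M \<Gamma> \<Delta> e)"
      unfolding k_def using M po poT e \<eta> unfolding pos_monad_def pos_functor_def by blast
    moreover have "pos_comp (TO M \<Delta>) (mult M \<Delta>) (TM M \<Delta> (TO M \<Delta>) (unit M \<Delta>)) = pos_id (TO M \<Delta>)"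
      using M po unfolding pos_monad_def by blast
    then have "mult M \<Delta> (TM M \<Delta> (TO M \<Delta>) (unit M \<Delta>) (TM M \<Gamma> \<Delta> e \<sigma>)) = TM M \<Gamma> \<Delta> e \<sigma>"
      using Te by (metis compose_eq restrict_apply')
    ultimately show ?thesis
      using \<sigma> by (simp add: kleisli_ext_def compose_def)
  qed
  moreover have "equation \<Delta> (op_term \<Delta> (kleisli_ext M \<Gamma> \<Delta> k \<sigma>))
      (App \<Gamma> \<sigma> (\<lambda>i \<in> Field \<Gamma>. op_term \<Delta> (k i))) \<subseteq> substitution_eqs Posf M"
    unfolding substitution_eqs_def using contexts k \<sigma> by blast
  ultimately have "eval_term A h (App \<Gamma> \<sigma> (\<lambda>i \<in> Field \<Gamma>. op_term \<Delta> (k i)))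
      = Some (opn A \<Delta> (TM M \<Gamma> \<Delta> e \<sigma>) h)"
    using satisfies_equationD[OF _ poA h] sat eval_op_term[OF h]
    by (metis (no_types, lifting) UnI1 subsetD)
  moreover have "eval_term A h (op_term \<Delta> (k i)) = Some (h (e i))" if i: "i \<in> Field \<Gamma>" for i
  proof -
    have "e i \<in> Field \<Delta>"
      using Pos0_D(2)[OF e i] .
    then have "equation \<Delta> (op_term \<Delta> (unit M \<Delta> (e i))) (Var (e i)) \<subseteq> unit_eqs Posf M"
      unfolding unit_eqs_def using contexts by blast
    then have "eval_term A h (op_term \<Delta> (unit M \<Delta> (e i))) = eval_term A h (Var (e i))"
      using satisfies_equationD(2)[OF _ poA h] sat by (meson UnI2 subsetD)
    then show ?thesis
      using i by (simp add: k_def compose_def)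
  qed
  then have "(\<lambda>i \<in> Field \<Gamma>. the (eval_term A h ((\<lambda>i \<in> Field \<Gamma>. op_term \<Delta> (k i)) i)))
      = pos_comp \<Gamma> h e"
    unfolding compose_def by (intro restrict_ext) simp
  ultimately show ?thesis
    by (simp split: if_splits)
qed

lemma enriched_imp_coherent:
  fixes Posf :: "'u rel set"
  assumes universe: "infinite (UNIV :: 'u set)" and contexts: "representative_contexts Posf"
    and M: "pos_monad M" and enr: "enriched M" and A: "A \<in> assoc_variety Posf M"
  shows "coherent Posf (assoc_signature M) A"
  unfolding coherent_def
proof (intro ballI, clarify)
  fix \<Gamma> \<sigma> f g
  assume \<Gamma>: "\<Gamma> \<in> Posf" and "\<sigma> \<in> assoc_signature M \<Gamma>" and fg: "(f, g) \<in> Pos \<Gamma> (pos A)"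
  then have \<sigma>: "\<sigma> \<in> Field (TO M \<Gamma>)"
    by (simp add: assoc_signature_def)
  have po\<Gamma>: "Partial_order \<Gamma>" and fin: "finite (Field \<Gamma>)"
    using contexts \<Gamma> by (auto simp: representative_contexts_def)
  have poA: "Partial_order (pos A)"
    using A by (auto simp: assoc_variety_def variety_def is_algebra_def)
  have "finite (Field (cylinder \<Gamma>))"
    using fin by (simp add: Field_cylinder)
  then obtain \<Delta> \<phi> \<psi> where \<Delta>: "\<Delta> \<in> Posf"
    and \<phi>: "\<phi> \<in> Pos0 (cylinder \<Gamma>) \<Delta>" and \<psi>: "\<psi> \<in> Pos0 \<Delta> (cylinder \<Gamma>)"
    and retract: "\<And>z. z \<in> Field (cylinder \<Gamma>) \<Longrightarrow> \<psi> (\<phi> z) = z"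
    using finite_poset_context[OF universe contexts Partial_order_cylinder[OF po\<Gamma>]] by blast
  have po\<Delta>: "Partial_order \<Delta>"
    using contexts \<Delta> by (auto simp: representative_contexts_def)
  \<comment> \<open>\<open>h\<close> is the pair \<open>f \<le> g\<close> read as a map out of \<open>\<Delta>\<close>; \<open>e False \<le> e True\<close> are the end inclusions.\<close>
  define h where
    "h = pos_comp \<Delta> (\<lambda>(x, b) \<in> Field (cylinder \<Gamma>). if b then g x else f x) \<psi>"
  define e where "e b = (\<lambda>x \<in> Field \<Gamma>. \<phi> (x, b))" for b
  have h: "h \<in> Pos0 \<Delta> (pos A)"
    unfolding h_def using \<psi> pair_le_from_cylinder[OF poA fg] by (rule pos_comp_in_Pos0)
  have e: "e b \<in> Pos0 \<Gamma> \<Delta>" for b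
    unfolding e_def using Pos0_D(3)[OF \<phi>] by (intro restrict_in_Pos0) (simp add: cylinder_def)
  have "(\<phi> (x, False), \<phi> (x, True)) \<in> \<Delta>" if "x \<in> Field \<Gamma>" for x
    using that po\<Gamma> Pos0_D(3)[OF \<phi>] by (simp add: cylinder_def Partial_order_iff)
  then have "(e False, e True) \<in> Pos \<Gamma> \<Delta>"
    using e by (simp add: Pos_def e_def)
  then have "(TM M \<Gamma> \<Delta> (e False) \<sigma>, TM M \<Gamma> \<Delta> (e True) \<sigma>) \<in> TO M \<Delta>"
    using enr po\<Gamma> po\<Delta> \<sigma> unfolding enriched_def Pos_def by blast
  then have "(\<Delta>, op_term \<Delta> (TM M \<Gamma> \<Delta> (e False) \<sigma>), op_term \<Delta> (TM M \<Gamma> \<Delta> (e True) \<sigma>))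
      \<in> order_ineqs Posf M"
    unfolding order_ineqs_def using \<Delta> by blast
  then have "satisfies A
      (\<Delta>, op_term \<Delta> (TM M \<Gamma> \<Delta> (e False) \<sigma>), op_term \<Delta> (TM M \<Gamma> \<Delta> (e True) \<sigma>))"
    using A unfolding assoc_variety_def variety_def by blast
  then have "(opn A \<Delta> (TM M \<Gamma> \<Delta> (e False) \<sigma>) h, opn A \<Delta> (TM M \<Gamma> \<Delta> (e True) \<sigma>) h) \<in> pos A"
    using h eval_op_term[OF h] by auto
  moreover have "pos_comp \<Gamma> h (e b) = (if b then g else f)" for b
  proof (rule extensionalityI[of _ "Field \<Gamma>"])
    show "pos_comp \<Gamma> h (e b) \<in> extensional (Field \<Gamma>)"
      by (simp add: compose_def)
    show "(if b then g else f) \<in> extensional (Field \<Gamma>)"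
      using fg by (auto simp: Pos_def dest: Pos0_D(1))
    fix x assume x: "x \<in> Field \<Gamma>"
    then have "(x, b) \<in> Field (cylinder \<Gamma>)"
      by (simp add: Field_cylinder)
    then have "\<phi> (x, b) \<in> Field \<Delta>" and "\<psi> (\<phi> (x, b)) = (x, b)"
      using Pos0_D(2)[OF \<phi>] retract by auto
    then show "pos_comp \<Gamma> h (e b) x = (if b then g else f) x"
      using x by (simp add: h_def e_def compose_def Field_cylinder)
  qed
  ultimately show "(opn A \<Gamma> \<sigma> f, opn A \<Gamma> \<sigma> g) \<in> pos A"
    using opn_functor_action[OF M A \<Gamma> \<Delta> po\<Gamma> po\<Delta> e \<sigma> h, of False]
      opn_functor_action[OF M A \<Gamma> \<Delta> po\<Gamma> po\<Delta> e \<sigma> h, of True] by simp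
qed

section \<open>Subalgebras\<close>

definition subalgebra :: "('u, 's, 'a) algebra \<Rightarrow> 'a set \<Rightarrow> ('u, 's, 'a) algebra" where
  "subalgebra A S = A\<lparr>pos := pos A \<inter> S \<times> S\<rparr>"

definition closed_under ::
  "'u rel set \<Rightarrow> ('u, 's) signature \<Rightarrow> ('u, 's, 'a) algebra \<Rightarrow> 'a set \<Rightarrow> bool" where
  "closed_under Posf \<Sigma> A S \<longleftrightarrow>
     S \<subseteq> Field (pos A) \<and>
     (\<forall>\<Gamma> \<in> Posf. \<forall>\<sigma> \<in> \<Sigma> \<Gamma>. \<forall>f \<in> Pos0 \<Gamma> (pos A). f ` Field \<Gamma> \<subseteq> S \<longrightarrow> opn A \<Gamma> \<sigma> f \<in> S)"

lemma subalgebra_simps [simp]: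
  "pos (subalgebra A S) = pos A \<inter> S \<times> S" "opn (subalgebra A S) = opn A"
  by (simp_all add: subalgebra_def)

lemma Pos0_subposet:
  assumes "Partial_order X" "S \<subseteq> Field X"
  shows "f \<in> Pos0 \<Gamma> (X \<inter> S \<times> S) \<longleftrightarrow> f \<in> Pos0 \<Gamma> X \<and> f ` Field \<Gamma> \<subseteq> S"
proof -
  have "x \<in> Field \<Gamma> \<and> x' \<in> Field \<Gamma>" if "(x, x') \<in> \<Gamma>" for x x'
    using that by (auto simp: Field_def)
  then show ?thesis
    using assms(2) unfolding Pos0_def Field_subposet[OF assms] image_subset_iff PiE_iff
    by blast
qed

lemma coherentD:
  assumes "coherent Posf \<Sigma> A" "\<Gamma> \<in> Posf" "\<sigma> \<in> \<Sigma> \<Gamma>" "(f, g) \<in> Pos \<Gamma> (pos A)"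
  shows "(opn A \<Gamma> \<sigma> f, opn A \<Gamma> \<sigma> g) \<in> pos A"
  using assms unfolding coherent_def by blast

text \<open>
  Definedness of a term depends only on comparisons between values of subterms; in a subalgebra
  these values lie in \<open>S\<close>, where the two orders agree.
\<close>

lemma eval_term_subalgebra:
  assumes S: "closed_under Posf \<Sigma> A S"
    and f: "f ` Field \<Gamma> \<subseteq> S" and t: "t \<in> terms Posf \<Sigma> \<Gamma>"
  shows "eval_term (subalgebra A S) f t = eval_term A f t \<and>
    (\<forall>a. eval_term A f t = Some a \<longrightarrow> a \<in> S)"
  using t
proof (induction rule: terms.induct)
  case (Var x)
  then show ?case using f by auto
next
  case (App \<Delta> \<sigma> g)
  define v where "v = (\<lambda>i \<in> Field \<Delta>. the (eval_term A f (g i)))"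
  let ?def = "\<lambda>R. (\<forall>i \<in> Field \<Delta>. eval_term A f (g i) \<noteq> None) \<and>
    (\<forall>i j. (i, j) \<in> \<Delta> \<longrightarrow> (the (eval_term A f (g i)), the (eval_term A f (g j))) \<in> R)"
  have IH: "eval_term (subalgebra A S) f (g i) = eval_term A f (g i)"
    "\<And>a. eval_term A f (g i) = Some a \<Longrightarrow> a \<in> S" if "i \<in> Field \<Delta>" for i
    using App.IH that by auto
  have Field: "i \<in> Field \<Delta>" "j \<in> Field \<Delta>" if "(i, j) \<in> \<Delta>" for i j
    using that by (auto simp: Field_def)
  have inS: "the (eval_term A f (g i)) \<in> S" if "i \<in> Field \<Delta>" "eval_term A f (g i) \<noteq> None" for i
    using IH(2) that by auto
  have v: "opn A \<Delta> \<sigma> v \<in> S" if d: "?def (pos A)"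
  proof -
    have "v \<in> Pos0 \<Delta> (pos A)"
      unfolding v_def using d by (intro restrict_in_Pos0) auto
    moreover have "v ` Field \<Delta> \<subseteq> S"
      using d inS by (auto simp: v_def)
    ultimately show ?thesis
      using S App.hyps unfolding closed_under_def by blast
  qed
  have order_agrees: "?def (pos A \<inter> S \<times> S) \<longleftrightarrow> ?def (pos A)"
  proof (rule conj_cong[OF refl])
    assume "\<forall>i \<in> Field \<Delta>. eval_term A f (g i) \<noteq> None"
    then have "(the (eval_term A f (g i)), the (eval_term A f (g j))) \<in> pos A \<inter> S \<times> S \<longleftrightarrow>
        (the (eval_term A f (g i)), the (eval_term A f (g j))) \<in> pos A" if "(i, j) \<in> \<Delta>" for i j
      using Field[OF that] inS by simp
    then show "(\<forall>i j. (i, j) \<in> \<Delta> \<longrightarrow>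
          (the (eval_term A f (g i)), the (eval_term A f (g j))) \<in> pos A \<inter> S \<times> S) \<longleftrightarrow>
        (\<forall>i j. (i, j) \<in> \<Delta> \<longrightarrow> (the (eval_term A f (g i)), the (eval_term A f (g j))) \<in> pos A)"
      by meson
  qed
  have sub: "eval_term (subalgebra A S) f (App \<Delta> \<sigma> g) =
      (if ?def (pos A) then Some (opn A \<Delta> \<sigma> v) else None)"
  proof -
    have v': "(\<lambda>i \<in> Field \<Delta>. the (eval_term (subalgebra A S) f (g i))) = v"
      unfolding v_def by (rule restrict_ext) (simp add: IH(1))
    have def: "(\<forall>i \<in> Field \<Delta>. eval_term (subalgebra A S) f (g i) \<noteq> None) \<longleftrightarrow>
        (\<forall>i \<in> Field \<Delta>. eval_term A f (g i) \<noteq> None)"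
      using IH(1) by simp
    have mono: "(\<forall>i j. (i, j) \<in> \<Delta> \<longrightarrow> (the (eval_term (subalgebra A S) f (g i)),
          the (eval_term (subalgebra A S) f (g j))) \<in> R) \<longleftrightarrow>
        (\<forall>i j. (i, j) \<in> \<Delta> \<longrightarrow> (the (eval_term A f (g i)), the (eval_term A f (g j))) \<in> R)" for R
      using IH(1) Field by metis
    show ?thesis
      by (simp only: eval_term.simps subalgebra_simps v' def mono order_agrees)
  qed
  have "eval_term A f (App \<Delta> \<sigma> g) = (if ?def (pos A) then Some (opn A \<Delta> \<sigma> v) else None)"
    by (simp only: eval_term.simps v_def)
  with sub v show ?case
    by (cases "?def (pos A)") (simp_all only: if_True if_False option.inject, simp_all)
qed

lemma subalgebra_in_coherent_variety:
  assumes A: "A \<in> coherent_variety Posf \<Sigma> I" and I: "I \<subseteq> inequations Posf \<Sigma>"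
    and S: "closed_under Posf \<Sigma> A S"
  shows "subalgebra A S \<in> coherent_variety Posf \<Sigma> I"
proof -
  have alg: "is_algebra Posf \<Sigma> A" and sat: "\<And>q. q \<in> I \<Longrightarrow> satisfies A q"
    and coh: "coherent Posf \<Sigma> A"
    using A by (auto simp: coherent_variety_def variety_def)
  have po: "Partial_order (pos A)" and SF: "S \<subseteq> Field (pos A)"
    using alg S by (auto simp: is_algebra_def closed_under_def)
  note Pos0_S = Pos0_subposet[OF po SF] and Field_S = Field_subposet[OF po SF]
  have "Partial_order (pos A \<inter> S \<times> S)"
    unfolding Partial_order_iff unfolding Field_S
  proof (intro conjI)
    show "\<forall>x \<in> S. (x, x) \<in> pos A \<inter> S \<times> S"
      using po SF by (auto simp: Partial_order_iff)
    show "trans (pos A \<inter> S \<times> S)"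
      using po by (intro trans_Restr) (simp add: Partial_order_iff)
    show "antisym (pos A \<inter> S \<times> S)"
      using po by (intro antisym_subset[of "pos A \<inter> S \<times> S" "pos A"]) (simp_all add: Partial_order_iff)
  qed
  then have "is_algebra Posf \<Sigma> (subalgebra A S)"
    using S by (simp add: is_algebra_def Field_S Pos0_S closed_under_def)
  moreover have "satisfies (subalgebra A S) q" if "q \<in> I" for q
  proof -
    obtain \<Gamma> s t where q: "q = (\<Gamma>, s, t)"
      by (cases q)
    have st: "s \<in> terms Posf \<Sigma> \<Gamma>" "t \<in> terms Posf \<Sigma> \<Gamma>"
      using I that q by (auto simp: inequations_def)
    have "\<exists>a b. eval_term (subalgebra A S) f s = Some a \<and> eval_term (subalgebra A S) f t = Some b \<and>
        (a, b) \<in> pos A \<inter> S \<times> S" if f: "f \<in> Pos0 \<Gamma> (pos A)" "f ` Field \<Gamma> \<subseteq> S" for f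
    proof -
      obtain a b where "eval_term A f s = Some a" "eval_term A f t = Some b" "(a, b) \<in> pos A"
        using sat[OF \<open>q \<in> I\<close>] f(1) q by auto
      then show ?thesis
        using eval_term_subalgebra[OF S f(2)] st by auto
    qed
    then show ?thesis
      unfolding q satisfies.simps subalgebra_simps Ball_def Pos0_S by blast
  qed
  moreover have "coherent Posf \<Sigma> (subalgebra A S)"
    unfolding coherent_def
  proof (intro ballI, clarify)
    fix \<Gamma> \<sigma> f g
    assume \<sigma>: "\<Gamma> \<in> Posf" "\<sigma> \<in> \<Sigma> \<Gamma>" and "(f, g) \<in> Pos \<Gamma> (pos (subalgebra A S))"
    then have f: "f \<in> Pos0 \<Gamma> (pos A)" "f ` Field \<Gamma> \<subseteq> S"
      and g: "g \<in> Pos0 \<Gamma> (pos A)" "g ` Field \<Gamma> \<subseteq> S" and "(f, g) \<in> Pos \<Gamma> (pos A)"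
      by (simp_all add: Pos_def Pos0_S)
    then have "(opn A \<Gamma> \<sigma> f, opn A \<Gamma> \<sigma> g) \<in> pos A"
      using coherentD[OF coh \<sigma>] by simp
    moreover have "opn A \<Gamma> \<sigma> f \<in> S" "opn A \<Gamma> \<sigma> g \<in> S"
      using S \<sigma> f g unfolding closed_under_def by blast+
    ultimately show "(opn (subalgebra A S) \<Gamma> \<sigma> f, opn (subalgebra A S) \<Gamma> \<sigma> g)
        \<in> pos (subalgebra A S)"
      by simp
  qed
  ultimately show ?thesis
    by (simp add: coherent_variety_def variety_def)
qed

section \<open>Free-algebra monads of coherent varieties\<close>

text \<open>
  The inserter of two homomorphisms, the largest subposet on which \<open>p \<le> q\<close>.  This is where
  coherence enters: from \<open>p \<cdot> f \<le> q \<cdot> f\<close> one has to conclude that an operation of \<open>B\<close> preserves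
  the inequality.  For algebras that are not
  coherent, only the equaliser of \<open>p\<close> and \<open>q\<close> is a subalgebra in general.
\<close>

lemma closed_under_inserter:
  assumes A: "is_algebra Posf \<Sigma> A" and B: "coherent Posf \<Sigma> B"
    and p: "p \<in> homs Posf \<Sigma> A B" and q: "q \<in> homs Posf \<Sigma> A B"
  shows "closed_under Posf \<Sigma> A {a \<in> Field (pos A). (p a, q a) \<in> pos B}"
  unfolding closed_under_def
proof (intro conjI ballI impI)
  let ?S = "{a \<in> Field (pos A). (p a, q a) \<in> pos B}"
  show "?S \<subseteq> Field (pos A)" by blast
  fix \<Gamma> \<sigma> f
  assume \<sigma>: "\<Gamma> \<in> Posf" "\<sigma> \<in> \<Sigma> \<Gamma>" and f: "f \<in> Pos0 \<Gamma> (pos A)" and fS: "f ` Field \<Gamma> \<subseteq> ?S"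
  have "(pos_comp \<Gamma> p f, pos_comp \<Gamma> q f) \<in> Pos \<Gamma> (pos B)"
    using p q f fS pos_comp_in_Pos0[OF f] by (auto simp: homs_def Pos_def compose_def)
  then have "(opn B \<Gamma> \<sigma> (pos_comp \<Gamma> p f), opn B \<Gamma> \<sigma> (pos_comp \<Gamma> q f)) \<in> pos B"
    by (rule coherentD[OF B \<sigma>])
  then show "opn A \<Gamma> \<sigma> f \<in> ?S"
    using A p q \<sigma> f by (auto simp: is_algebra_def homs_def)
qed

lemma left_adjoint_forgetfulD:
  assumes "left_adjoint_forgetful Posf \<Sigma> V F \<eta>" and "Partial_order X"
  shows "F X \<in> V" and "\<eta> X \<in> Pos0 X (pos (F X))"
    and "\<And>A f. A \<in> V \<Longrightarrow> f \<in> Pos0 X (pos A) \<Longrightarrow>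
      \<exists>!h. h \<in> homs Posf \<Sigma> (F X) A \<and> pos_comp X h (\<eta> X) = f"
proof -
  note univ = assms(1)[unfolded left_adjoint_forgetful_def, THEN spec, THEN mp, OF assms(2)]
  show "F X \<in> V" and "\<eta> X \<in> Pos0 X (pos (F X))"
    by (rule conjunct1[OF univ], rule conjunct1[OF conjunct2[OF univ]])
  show "\<exists>!h. h \<in> homs Posf \<Sigma> (F X) A \<and> pos_comp X h (\<eta> X) = f"
    if "A \<in> V" "f \<in> Pos0 X (pos A)" for A f
    using conjunct2[OF conjunct2[OF univ], THEN bspec, OF that(1), THEN bspec, OF that(2)] .
qed

text \<open>
  The universal arrow corestricted to the subalgebra on \<open>S\<close> extends to a homomorphism from \<open>F X\<close>
  into it.  Composed with the inclusion, it is an endomorphism of \<open>F X\<close> fixing the generators,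
  hence the identity, so every element lies in \<open>S\<close>.
\<close>

lemma free_algebra_induct:
  assumes adj: "left_adjoint_forgetful Posf \<Sigma> (coherent_variety Posf \<Sigma> I) F \<eta>"
    and I: "I \<subseteq> inequations Posf \<Sigma>" and X: "Partial_order X"
    and S: "closed_under Posf \<Sigma> (F X) S" and gen: "\<eta> X ` Field X \<subseteq> S"
  shows "Field (pos (F X)) \<subseteq> S"
proof
  let ?A = "F X"
  note A = left_adjoint_forgetfulD(1)[OF adj X] and \<eta> = left_adjoint_forgetfulD(2)[OF adj X]
    and ext = left_adjoint_forgetfulD(3)[OF adj X]
  have po: "Partial_order (pos ?A)" and SF: "S \<subseteq> Field (pos ?A)"
    using A S by (auto simp: coherent_variety_def variety_def is_algebra_def closed_under_def)
  note Pos0_S = Pos0_subposet[OF po SF]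
  have "\<eta> X \<in> Pos0 X (pos (subalgebra ?A S))"
    using \<eta> gen by (simp add: Pos0_S)
  then obtain h where h: "h \<in> homs Posf \<Sigma> ?A (subalgebra ?A S)" "pos_comp X h (\<eta> X) = \<eta> X"
    using ext[OF subalgebra_in_coherent_variety[OF A I S]] by blast
  from h(1) have "h \<in> homs Posf \<Sigma> ?A ?A" and hS: "h ` Field (pos ?A) \<subseteq> S"
    by (auto simp: homs_def Pos0_S)
  moreover have "pos_id (pos ?A) \<in> homs Posf \<Sigma> ?A ?A"
  proof -
    have "pos_id (pos ?A) \<in> Pos0 (pos ?A) (pos ?A)"
      by (rule restrict_in_Pos0)
    moreover have "pos_comp \<Gamma> (pos_id (pos ?A)) f = f"
      if "\<Gamma> \<in> Posf" "f \<in> Pos0 \<Gamma> (pos ?A)" for \<Gamma> f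
      using Pos0_D(1,2)[OF that(2)] by (auto simp: compose_def fun_eq_iff extensional_def)
    moreover have "is_algebra Posf \<Sigma> ?A"
      using A by (simp add: coherent_variety_def variety_def)
    ultimately show ?thesis
      by (simp add: homs_def is_algebra_def)
  qed
  moreover have "pos_comp X (pos_id (pos ?A)) (\<eta> X) = \<eta> X"
    using Pos0_D(1,2)[OF \<eta>] by (auto simp: compose_def fun_eq_iff extensional_def)
  ultimately have "h = pos_id (pos ?A)"
    using ext[OF A \<eta>] h(2) by blast
  then show "a \<in> S" if "a \<in> Field (pos ?A)" for a
    using hS that by auto
qed

lemma hom_ext_mono:
  assumes adj: "left_adjoint_forgetful Posf \<Sigma> (coherent_variety Posf \<Sigma> I) F \<eta>"
    and I: "I \<subseteq> inequations Posf \<Sigma>" and X: "Partial_order X"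
    and A: "A \<in> coherent_variety Posf \<Sigma> I" and pq: "(p, q) \<in> Pos X (pos A)"
  shows "(hom_ext Posf \<Sigma> F \<eta> X A p, hom_ext Posf \<Sigma> F \<eta> X A q) \<in> Pos (pos (F X)) (pos A)"
proof -
  let ?ext = "hom_ext Posf \<Sigma> F \<eta> X A"
  note FX = left_adjoint_forgetfulD(1)[OF adj X] and \<eta> = left_adjoint_forgetfulD(2)[OF adj X]
    and univ = left_adjoint_forgetfulD(3)[OF adj X A]
  have ext: "?ext f \<in> homs Posf \<Sigma> (F X) A" "pos_comp X (?ext f) (\<eta> X) = f"
    if "f \<in> Pos0 X (pos A)" for f
    using theI'[OF univ[OF that]] unfolding hom_ext_def by auto
  have p: "p \<in> Pos0 X (pos A)" and q: "q \<in> Pos0 X (pos A)"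
    and le: "\<And>x. x \<in> Field X \<Longrightarrow> (p x, q x) \<in> pos A"
    using pq by (auto simp: Pos_def)
  let ?S = "{a \<in> Field (pos (F X)). (?ext p a, ?ext q a) \<in> pos A}"
  have S: "closed_under Posf \<Sigma> (F X) ?S"
    using FX A ext(1)[OF p] ext(1)[OF q]
    by (intro closed_under_inserter) (auto simp: coherent_variety_def variety_def)
  have "?ext p (\<eta> X x) = p x" "?ext q (\<eta> X x) = q x" if "x \<in> Field X" for x
    using that fun_cong[OF ext(2)[OF p], of x] fun_cong[OF ext(2)[OF q], of x]
    by (auto simp: compose_def)
  then have "\<eta> X ` Field X \<subseteq> ?S"
    using le Pos0_D(2)[OF \<eta>] by auto
  then have "Field (pos (F X)) \<subseteq> ?S"
    by (rule free_algebra_induct[OF adj I X S])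
  then show ?thesis
    using ext(1)[OF p] ext(1)[OF q] by (auto simp: Pos_def homs_def)
qed

lemma coherent_imp_enriched:
  fixes F :: "'u rel \<Rightarrow> ('u, 's, 'u) algebra"
  assumes I: "I \<subseteq> inequations Posf \<Sigma>"
    and adj: "left_adjoint_forgetful Posf \<Sigma> (coherent_variety Posf \<Sigma> I) F \<eta>"
  shows "enriched (free_algebra_monad Posf \<Sigma> F \<eta>)"
  unfolding enriched_def
proof (intro allI impI, elim conjE)
  fix X Y :: "'u rel" and f g
  assume X: "Partial_order X" and Y: "Partial_order Y" and fg: "(f, g) \<in> Pos X Y"
  note FY = left_adjoint_forgetfulD(1)[OF adj Y] and \<eta> = left_adjoint_forgetfulD(2)[OF adj Y]
  have "(pos_comp X (\<eta> Y) f, pos_comp X (\<eta> Y) g) \<in> Pos X (pos (F Y))"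
    using fg pos_comp_in_Pos0[OF _ \<eta>] Pos0_D(3)[OF \<eta>] by (auto simp: Pos_def compose_def)
  from hom_ext_mono[OF adj I X FY this]
  show "(TM (free_algebra_monad Posf \<Sigma> F \<eta>) X Y f, TM (free_algebra_monad Posf \<Sigma> F \<eta>) X Y g)
      \<in> Pos (TO (free_algebra_monad Posf \<Sigma> F \<eta>) X) (TO (free_algebra_monad Posf \<Sigma> F \<eta>) Y)"
    by (simp add: free_algebra_monad_def)
qed

theorem proposition4p6:
  fixes Posf :: "'u rel set"
  assumes universe: "infinite (UNIV :: 'u set)"
    and contexts: "representative_contexts Posf"
  shows "(\<forall>M :: 'u pmonad. pos_monad M \<and> finitary M \<and> enriched M \<longrightarrow>
            (\<forall>A \<in> (assoc_variety Posf M :: ('u, 'u, 'a) algebra set).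
               coherent Posf (assoc_signature M) A)) \<and>
         (\<forall>(\<Sigma> :: ('u, 's) signature) I F \<eta>.
            I \<subseteq> inequations Posf \<Sigma> \<and>
            left_adjoint_forgetful Posf \<Sigma> (coherent_variety Posf \<Sigma> I) F \<eta> \<longrightarrow>
            enriched (free_algebra_monad Posf \<Sigma> F \<eta>))"
  using enriched_imp_coherent[OF universe contexts] coherent_imp_enriched by blast

end
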